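(* Let $A\in\mathbb{C}^{m\times n}$, $A\neq O$, with $\mathrm{rank}(A)<n$ and let $\mathbf{b}\in\mathrm{range}(A)$. Assume $\tilde{\mathbf{x}}\in\mathbb{C}^n$ is an exact solution of $\tilde A\mathbf{x}=\tilde{\mathbf{b}}$ for some $(\tilde A,\tilde{\mathbf{b}})\in\mathbb{C}^{m\times n}\times\mathbb{C}^m$ with $\|\tilde A-A\|_2\le 0.46\,\|A^\dagger\|_2^{-1}$. Write $\Delta A=A-\tilde A$ and $\Delta\mathbf{b}=\mathbf{b}-\tilde{\mathbf{b}}$. Then there is an exact solution $\mathbf{x}_*\in\mathbb{C}^n$ of $A\mathbf{x}=\mathbf{b}$ such that $$\frac{\|\tilde{\mathbf{x}}-\mathbf{x}_*\|_2}{\|\mathbf{x}_*\|_2}\le\frac{\|A\|_2\,\|A^\dagger\|_2}{1-\|A^\dagger\|_2\,\|\Delta A\|_2}\left(2\sqrt2\,\frac{\|\Delta A\|_2}{\|A\|_2}+\frac{\|\Delta\mathbf{b}\|_2}{\|\mathbf{b}\|_2}\right)$$ if $\mathbf{b}\ne\mathbf{0}$, or $$\|\tilde{\mathbf{x}}-\mathbf{x}_*\|_2\le\frac{\|A\|_2\,\|A^\dagger\|_2}{1-\|A^\dagger\|_2\,\|\Delta A\|_2}\left(\|\tilde{\mathbf{x}}\|_2\,\frac{\|\Delta A\|_2}{\|A\|_2}+\frac{\|\Delta\mathbf{b}\|_2}{\|A\|_2}\right)$$ if $\mathbf{b}=\mathbf{0}$.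
   Context: $A^\dagger$ is the Moore-Penrose inverse, $\|\cdot\|_2$ is the Euclidean vector norm or the spectral matrix norm, and for $A\ne O$ the number $\|A^\dagger\|_2^{-1}$ is the smallest positive singular value of $A$. *)

theory Defs
  imports "HOL-Analysis.Analysis"
begin

definition conj_transpose :: "complex^'n^'m \<Rightarrow> complex^'m^'n" where
  "conj_transpose A = (\<chi> i j. cnj (A $ j $ i))"

text \<open>The four Penrose conditions, which characterize the Moore-Penrose inverse uniquely.\<close>

definition is_moore_penrose :: "complex^'n^'m \<Rightarrow> complex^'m^'n \<Rightarrow> bool" where
  "is_moore_penrose A X \<longleftrightarrow>
     A ** X ** A = A \<and>
     X ** A ** X = X \<and>
     conj_transpose (A ** X) = A ** X \<and>
     conj_transpose (X ** A) = X ** A"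

definition pinv :: "complex^'n^'m \<Rightarrow> complex^'m^'n" where
  "pinv A = (THE X. is_moore_penrose A X)"

text \<open>
  The norm of \<open>complex^'n\<close> is the Euclidean norm, so the operator norm of the induced map is
  the spectral norm.  The library's \<open>norm\<close> on matrices is the Frobenius norm.
\<close>

definition spectral_norm :: "complex^'n^'m \<Rightarrow> real" where
  "spectral_norm A = onorm ((*v) A)"

end

theory Submission
  imports Defs
begin

text \<open>
  Let \<open>x\<close> be the orthogonal projection of \<open>x'\<close> onto the affine space of solutions of
  \<open>A x = b\<close>, that is \<open>x = x' - A\<^sup>\<dagger> (A x' - b)\<close>.  The residual of \<open>x'\<close> in the
  unperturbed system is \<open>A x' - b = \<Delta>A x' - \<Delta>b\<close>, because \<open>x'\<close> solves the perturbed one, so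
  \<open>\<parallel>x' - x\<parallel> \<le> \<parallel>A\<^sup>\<dagger>\<parallel> (\<parallel>\<Delta>A\<parallel> \<parallel>x'\<parallel> + \<parallel>\<Delta>b\<parallel>)\<close>.
  For \<open>b = 0\<close> this is already sharper than the claim, as the denominator \<open>1 - \<parallel>A\<^sup>\<dagger>\<parallel> \<parallel>\<Delta>A\<parallel>\<close> is
  at most one, and it is positive by the bound on the perturbation.  For \<open>b \<noteq> 0\<close>, the estimate
  \<open>\<parallel>x'\<parallel> \<le> \<parallel>x\<parallel> + \<parallel>x' - x\<parallel>\<close> turns \<open>\<parallel>x'\<parallel>\<close> into \<open>\<parallel>x\<parallel>\<close> at the price of that
  denominator, and \<open>\<parallel>b\<parallel> \<le> \<parallel>A\<parallel> \<parallel>x\<parallel>\<close> turns \<open>\<parallel>\<Delta>b\<parallel> / \<parallel>x\<parallel>\<close> into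
  \<open>\<parallel>A\<parallel> \<parallel>\<Delta>b\<parallel> / \<parallel>b\<parallel>\<close>.  The matrix perturbation then enters with the factor
  \<open>1 \<le> 2 \<surd>2\<close>.

  That \<open>x\<close> solves \<open>A x = b\<close> is the Penrose condition \<open>A A\<^sup>\<dagger> A = A\<close>.  Since \<open>pinv\<close> is
  given by a definite description, this condition for it requires existence and uniqueness of the
  Moore-Penrose inverse (\<open>exists_moore_penrose\<close>, \<open>moore_penrose_unique\<close>).  Existence comes from
  Zlobec's formula \<open>A\<^sup>\<dagger> = H (H A H)\<^sup>- H\<close>, where \<open>H\<close> is the conjugate transpose of \<open>A\<close> and
  \<open>M\<^sup>-\<close> is any matrix with \<open>M M\<^sup>- M = M\<close>.  This replaces the singular value decomposition by
  linear algebra over a field and cancellation rules for conjugate transposes.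
\<close>

section \<open>Conjugate transposes\<close>

lemma conj_transpose_conj_transpose [simp]: "conj_transpose (conj_transpose A) = A"
  by (simp add: conj_transpose_def vec_eq_iff)

lemma conj_transpose_mult: "conj_transpose (A ** B) = conj_transpose B ** conj_transpose A"
  by (simp add: conj_transpose_def matrix_matrix_mult_def vec_eq_iff mult.commute)

lemma matrix_mult_diff_right:
  fixes A :: "'a::ring_1^'n^'m"
  shows "A ** (B - C) = A ** B - A ** C"
  by (simp add: matrix_matrix_mult_def vec_eq_iff right_diff_distrib sum_subtractf)

text \<open>The diagonal entries of the Gram matrix are the squared norms of the columns of \<open>A\<close>.\<close>

lemma gram_matrix_eq_0D:
  assumes "conj_transpose A ** A = 0"
  shows "A = 0"
proof -
  have "A $ k $ i = 0" for i k
  proof -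
    have "(\<Sum>k\<in>UNIV. cnj (A $ k $ i) * A $ k $ i) = (conj_transpose A ** A) $ i $ i"
      by (simp add: conj_transpose_def matrix_matrix_mult_def)
    also have "\<dots> = 0"
      using assms by simp
    finally have "of_real (\<Sum>k\<in>UNIV. (cmod (A $ k $ i))\<^sup>2) = (0::complex)"
      by (simp add: complex_norm_square mult.commute del: of_real_power)
    then have "(\<Sum>k\<in>UNIV. (cmod (A $ k $ i))\<^sup>2) = 0"
      by (simp only: of_real_eq_0_iff)
    then show ?thesis
      by (simp add: sum_nonneg_eq_0_iff)
  qed
  then show ?thesis
    by (simp add: vec_eq_iff)
qed

text \<open>
  If \<open>H A W = 0\<close> with \<open>H\<close> the conjugate transpose of \<open>A\<close>, then the Gram matrix of \<open>A W\<close>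
  vanishes, since \<open>H A W\<close> is its right factor.  Here \<open>W = Y - Z\<close>.
\<close>

lemma conj_transpose_mult_cancel_left:
  assumes "conj_transpose A ** A ** Y = conj_transpose A ** A ** Z"
  shows "A ** Y = A ** Z"
proof -
  have "conj_transpose A ** (A ** (Y - Z)) = 0"
    using assms by (simp add: matrix_mul_assoc matrix_mult_diff_right)
  then have "conj_transpose (A ** (Y - Z)) ** (A ** (Y - Z)) = 0"
    by (simp add: conj_transpose_mult flip: matrix_mul_assoc)
  then have "A ** (Y - Z) = 0"
    by (rule gram_matrix_eq_0D)
  then show ?thesis
    by (simp add: matrix_mult_diff_right)
qed

lemma conj_transpose_mult_cancel_right:
  assumes "Y ** A ** conj_transpose A = Z ** A ** conj_transpose A"
  shows "Y ** A = Z ** A"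
proof -
  have "conj_transpose A ** conj_transpose Y = conj_transpose A ** conj_transpose Z"
    using arg_cong[OF assms, of conj_transpose]
    by - (rule conj_transpose_mult_cancel_left,
        simp add: conj_transpose_mult matrix_mul_assoc)
  then show ?thesis
    by (metis conj_transpose_mult conj_transpose_conj_transpose)
qed

section \<open>The Moore-Penrose inverse\<close>

text \<open>A linear right inverse of \<open>M\<close> on its range, extended to the whole space, will do.\<close>

lemma exists_inner_inverse:
  fixes M :: "'a::field^'n^'m"
  shows "\<exists>G. M ** G ** M = M"
proof -
  obtain g where g: "Vector_Spaces.linear (*s) (*s) g" "\<forall>v\<in>range ((*v) M). M *v g v = v"
    using vec.linear_exists_right_inverse_on[OF matrix_vector_mul_linear_gen vec.subspace_UNIV, of M]
    by auto
  have "M ** matrix g ** M = M"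
    using g(2) by (simp add: matrix_eq matrix_works[OF g(1)] flip: matrix_vector_mul_assoc)
  then show ?thesis ..
qed

text \<open>
  With \<open>M = H A H\<close> and \<open>M G M = M\<close>, the candidate is \<open>X = H G H\<close>.  Cancelling \<open>A H\<close> on
  the right of \<open>M G M = M\<close> gives \<open>H A X = H\<close>, and cancelling \<open>H A\<close> on the left gives
  \<open>X A H = H\<close>.  The Penrose conditions follow from these two equations.
\<close>

lemma exists_moore_penrose:
  "\<exists>X. is_moore_penrose A X"
proof -
  define H where "H = conj_transpose A"
  obtain G where G: "(H ** A ** H) ** G ** (H ** A ** H) = H ** A ** H"
    using exists_inner_inverse by blast
  define X where "X = H ** G ** H"
  have H: "conj_transpose H = A"
    by (simp add: H_def)
  have HAX: "H ** A ** X = H"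
  proof -
    have "((H ** A ** H ** G) ** H) ** A ** H = (mat 1 ** H) ** A ** H"
      using G by (simp add: matrix_mul_assoc)
    then have "(H ** A ** H ** G) ** H ** A = mat 1 ** H ** A"
      unfolding H_def by (rule conj_transpose_mult_cancel_right)
    then have "(H ** A ** H ** G) ** H = mat 1 ** H"
      using conj_transpose_mult_cancel_right[of _ H] by (simp only: H)
    then show ?thesis
      by (simp add: X_def matrix_mul_assoc)
  qed
  have XAH: "X ** A ** H = H"
  proof -
    have "H ** A ** (H ** G ** H ** A ** H) = H ** A ** H"
      using G by (simp add: matrix_mul_assoc)
    then have "A ** (H ** G ** H ** A ** H) = A ** H"
      unfolding H_def by (rule conj_transpose_mult_cancel_left)
    then have "H ** (G ** H ** A ** H) = H ** mat 1"
      using conj_transpose_mult_cancel_left[of H "G ** H ** A ** H" "mat 1"]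
      by (simp add: H matrix_mul_assoc)
    then show ?thesis
      by (simp add: X_def matrix_mul_assoc)
  qed
  \<comment> \<open>\<open>H A X = H\<close> makes the adjoint of \<open>A X\<close> equal to the Gram matrix of \<open>A X\<close>, which is Hermitian.\<close>
  have AX: "conj_transpose (A ** X) = A ** X"
  proof -
    have "conj_transpose (A ** X) ** (A ** X) = conj_transpose (A ** X)"
      using HAX by (simp add: conj_transpose_mult H_def[symmetric] flip: matrix_mul_assoc)
    then show ?thesis
      by (metis conj_transpose_mult conj_transpose_conj_transpose)
  qed
  have XA: "conj_transpose (X ** A) = X ** A"
  proof -
    have "(X ** A) ** conj_transpose (X ** A) = conj_transpose (X ** A)"
      using XAH by (simp add: conj_transpose_mult H_def[symmetric] matrix_mul_assoc)
    then show ?thesis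
      by (metis conj_transpose_mult conj_transpose_conj_transpose)
  qed
  have "A ** X ** A = conj_transpose (A ** X) ** A"
    by (simp only: AX)
  also have "\<dots> = conj_transpose (H ** A ** X)"
    by (simp only: conj_transpose_mult H matrix_mul_assoc)
  also have "\<dots> = A"
    by (simp only: HAX H)
  finally have "A ** X ** A = A" .
  moreover have "X ** A ** X = X"
  proof -
    have "X ** A ** X = X ** A ** H ** G ** H"
      by (simp only: X_def matrix_mul_assoc)
    then show ?thesis
      by (simp only: XAH) (simp only: X_def)
  qed
  ultimately show ?thesis
    using AX XA unfolding is_moore_penrose_def by blast
qed

text \<open>
  Two Moore-Penrose inverses yield the same products \<open>A X\<close> and \<open>X A\<close>: taking adjoints of
  \<open>A X = (A Y) (A X)\<close> reverses the two Hermitian factors, and \<open>(A X) (A Y) = A Y\<close>.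
\<close>

lemma moore_penrose_unique:
  assumes X: "is_moore_penrose A X" and Y: "is_moore_penrose A Y"
  shows "X = Y"
proof -
  have "A ** X = conj_transpose (A ** Y ** A ** X)"
    using X Y by (simp add: is_moore_penrose_def)
  also have "\<dots> = conj_transpose (A ** X) ** conj_transpose (A ** Y)"
    by (simp add: conj_transpose_mult matrix_mul_assoc)
  also have "\<dots> = A ** Y"
    using X Y by (simp add: is_moore_penrose_def matrix_mul_assoc)
  finally have AXY: "A ** X = A ** Y" .
  have "X ** A = conj_transpose (X ** A ** Y ** A)"
    using X Y by (simp add: is_moore_penrose_def flip: matrix_mul_assoc)
  also have "\<dots> = conj_transpose (Y ** A) ** conj_transpose (X ** A)"
    by (simp add: conj_transpose_mult matrix_mul_assoc)
  also have "\<dots> = Y ** A"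
    using X Y by (simp add: is_moore_penrose_def flip: matrix_mul_assoc)
  finally have XAY: "X ** A = Y ** A" .
  have "X = X ** A ** X"
    using X by (simp add: is_moore_penrose_def)
  also have "\<dots> = Y ** A ** Y"
    using AXY XAY by (metis matrix_mul_assoc)
  also have "\<dots> = Y"
    using Y by (simp add: is_moore_penrose_def)
  finally show ?thesis .
qed

lemma is_moore_penrose_pinv: "is_moore_penrose A (pinv A)"
proof -
  obtain X where X: "is_moore_penrose A X"
    using exists_moore_penrose by blast
  show ?thesis
    unfolding pinv_def using X moore_penrose_unique[OF _ X] by (rule theI)
qed

section \<open>The spectral norm\<close>

lemma norm_matrix_vector_le: "norm (A *v x) \<le> spectral_norm A * norm x"
  unfolding spectral_norm_def
  by (rule onorm) (simp add: linear_conv_bounded_linear[symmetric])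

lemma spectral_norm_nonneg: "0 \<le> spectral_norm A"
  unfolding spectral_norm_def
  by (rule onorm_pos_le) (simp add: linear_conv_bounded_linear[symmetric])

lemma spectral_norm_pos:
  assumes "A \<noteq> 0"
  shows "0 < spectral_norm A"
proof -
  obtain x where "A *v x \<noteq> 0"
    using assms by (metis matrix_eq matrix_vector_mult_0)
  then have "0 < spectral_norm A * norm x"
    using norm_matrix_vector_le[of A x] by (meson less_le_trans zero_less_norm_iff)
  then show ?thesis
    using spectral_norm_nonneg[of A] by (simp add: zero_less_mult_iff)
qed

lemma spectral_norm_diff_commute: "spectral_norm (A - B) = spectral_norm (B - A)"
proof -
  have "norm ((A - B) *v x) = norm ((B - A) *v x)" for x
    by (simp add: matrix_vector_mult_diff_rdistrib norm_minus_commute)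
  then show ?thesis
    by (simp add: spectral_norm_def onorm_def)
qed

section \<open>Perturbation of a consistent system\<close>

text \<open>
  The solution is the projection \<open>x' - A\<^sup>\<dagger> (A x' - b)\<close>; it solves \<open>A x = b\<close> because
  \<open>A A\<^sup>\<dagger>\<close> fixes \<open>A x' - b\<close>, which lies in the range of \<open>A\<close>.  The matrix \<open>A'\<close> splits
  the residual \<open>A x' - b\<close> into \<open>(A - A') x'\<close> and \<open>A' x' - b\<close>.
\<close>

lemma exists_solution_near:
  assumes "b \<in> range ((*v) A)"
  shows "\<exists>x. A *v x = b \<and> norm (x' - x) \<le> spectral_norm (pinv A)
           * (spectral_norm (A - A') * norm x' + norm (b - A' *v x'))"
proof -
  obtain y where y: "b = A *v y"
    using assms by blast
  define x where "x = x' - pinv A *v (A *v x' - b)"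
  have APA: "A *v (pinv A *v (A *v z)) = A *v z" for z
    using is_moore_penrose_pinv[of A]
    by (simp add: is_moore_penrose_def matrix_vector_mul_assoc matrix_mul_assoc)
  have "A *v x = b"
    by (simp add: x_def y matrix_vector_mult_diff_distrib APA)
  moreover have "norm (x' - x) \<le> spectral_norm (pinv A)
           * (spectral_norm (A - A') * norm x' + norm (b - A' *v x'))"
  proof -
    have "norm (A *v x' - b) = norm ((A - A') *v x' - (b - A' *v x'))"
      by (simp add: matrix_vector_mult_diff_rdistrib)
    also have "\<dots> \<le> norm ((A - A') *v x') + norm (b - A' *v x')"
      by (rule norm_triangle_ineq4)
    also have "\<dots> \<le> spectral_norm (A - A') * norm x' + norm (b - A' *v x')"
      by (rule add_right_mono) (rule norm_matrix_vector_le)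
    finally show ?thesis
      using norm_matrix_vector_le[of "pinv A" "A *v x' - b"] spectral_norm_nonneg[of "pinv A"]
      by (simp add: x_def) (meson mult_left_mono order_trans)
  qed
  ultimately show ?thesis
    by blast
qed

theorem theorem4:
  fixes A A' :: "complex^'n^'m"
    and b b' :: "complex^'m"
    and x' :: "complex^'n"
  assumes "A \<noteq> 0"
    and "rank A < CARD('n)"
    and "b \<in> range ((*v) A)"
    and "A' *v x' = b'"
    and "spectral_norm (A' - A) \<le> 0.46 * inverse (spectral_norm (pinv A))"
  shows "\<exists>x. A *v x = b \<and>
    (b \<noteq> 0 \<longrightarrow>
      norm (x' - x) / norm x \<le>
        spectral_norm A * spectral_norm (pinv A)
          / (1 - spectral_norm (pinv A) * spectral_norm (A - A'))
        * (2 * sqrt 2 * (spectral_norm (A - A') / spectral_norm A) + norm (b - b') / norm b)) \<and>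
    (b = 0 \<longrightarrow>
      norm (x' - x) \<le>
        spectral_norm A * spectral_norm (pinv A)
          / (1 - spectral_norm (pinv A) * spectral_norm (A - A'))
        * (norm x' * (spectral_norm (A - A') / spectral_norm A)
           + norm (b - b') / spectral_norm A))"
proof -
  define a p d r where "a = spectral_norm A" and "p = spectral_norm (pinv A)"
    and "d = spectral_norm (A - A')" and "r = norm (b - b')"
  obtain x where x: "A *v x = b" and "norm (x' - x) \<le> p * (d * norm x' + r)"
    using exists_solution_near[OF assms(3), of x' A'] assms(4)
    by (auto simp: p_def d_def r_def)
  note near = this(2)
  have a: "a > 0"
    unfolding a_def using assms(1) by (rule spectral_norm_pos)
  have nonneg: "p \<ge> 0" "d \<ge> 0" "r \<ge> 0"
    by (simp_all add: p_def d_def r_def spectral_norm_nonneg)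
  have pd: "p * d \<le> 0.46"
  proof -
    have "d \<le> 0.46 * inverse p"
      using assms(5) by (simp add: p_def d_def spectral_norm_diff_commute)
    then have "p * d \<le> p * (0.46 * inverse p)"
      using nonneg(1) by (rule mult_left_mono)
    also have "\<dots> \<le> 0.46"
      by (cases "p = 0") simp_all
    finally show ?thesis .
  qed
  then have pos: "1 - p * d > 0"
    by simp
  have "norm (x' - x) / norm x \<le> a * p / (1 - p * d) * (2 * sqrt 2 * (d / a) + r / norm b)"
    if "b \<noteq> 0"
  proof -
    have nx: "norm x > 0"
      using that x by auto
    have bx: "norm b \<le> a * norm x"
      using norm_matrix_vector_le[of A x] x by (simp add: a_def)
    \<comment> \<open>Bounding \<open>x'\<close> by \<open>x\<close> makes the error appear on both sides; absorbing it on the left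
      leaves the factor \<open>1 - p * d\<close>.\<close>
    have "norm x' \<le> norm x + norm (x' - x)"
      using norm_triangle_ineq2[of x' x] by simp
    then have "p * (d * norm x') \<le> p * (d * (norm x + norm (x' - x)))"
      using nonneg by (intro mult_left_mono)
    then have "(1 - p * d) * norm (x' - x) \<le> p * (d * norm x + r)"
      using near by (simp add: algebra_simps)
    then have "norm (x' - x) \<le> p * (d * norm x + r) / (1 - p * d)"
      using pos by (simp add: field_simps)
    then have "norm (x' - x) / norm x \<le> p * (d * norm x + r) / (1 - p * d) / norm x"
      by (rule divide_right_mono) simp
    also have "\<dots> = p / (1 - p * d) * (d + r / norm x)"
      using nx pos by (simp add: field_simps)
    also have "\<dots> \<le> p / (1 - p * d) * (2 * sqrt 2 * d + a * (r / norm b))"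
    proof -
      have "1 * d \<le> (2 * sqrt 2) * d"
        using nonneg(2) real_sqrt_ge_one[of 2] by (intro mult_right_mono) linarith+
      moreover have "r / norm x \<le> a * (r / norm b)"
        using mult_left_mono[OF bx nonneg(3)] nx that by (simp add: field_simps)
      ultimately show ?thesis
        using nonneg(1) pos by (intro mult_left_mono) auto
    qed
    also have "\<dots> = a * p / (1 - p * d) * (2 * sqrt 2 * (d / a) + r / norm b)"
      using a pos by (simp add: distrib_left mult.assoc)
    finally show ?thesis .
  qed
  moreover have "norm (x' - x) \<le> a * p / (1 - p * d) * (norm x' * (d / a) + r / a)"
  proof -
    have "p * (d * norm x' + r) \<le> p * (d * norm x' + r) / (1 - p * d)"
      using pos nonneg by (simp add: le_divide_eq mult_left_le)
    also have "\<dots> = a * p / (1 - p * d) * ((d * norm x' + r) / a)"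
      using a by simp
    also have "(d * norm x' + r) / a = norm x' * (d / a) + r / a"
      by (simp add: add_divide_distrib)
    finally show ?thesis
      using near by simp
  qed
  ultimately show ?thesis
    using x unfolding a_def p_def d_def r_def by blast
qed

end
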